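(* Let $m \ge 1$ and let $n_1,\ldots,n_m$ be positive integers. Let $A$ be the square block diagonal matrix whose diagonal blocks are $J_{n_1},\ldots,J_{n_m}$ (all entries outside these blocks being $0$), where $J_{n_i}$ is the $n_i\times n_i$ matrix all of whose entries equal $1$. Then the spectral radius of $A$ equals the dimension of the largest all-ones block of $A$, i.e. $\rho(A)=\max_{1\le i\le m} n_i$.
   Context: For a square matrix $A$, the spectral radius $\rho(A)$ is the largest magnitude (absolute value) of an eigenvalue of $A$. For a positive integer $k$, $J_k$ denotes the $k\times k$ matrix with every entry equal to $1$. *)

theory Defs
  imports "Jordan_Normal_Form.Spectral_Radius"
begin

definition all_ones_mat :: "nat \<Rightarrow> 'a :: one mat" where
  "all_ones_mat k = mat k k (\<lambda>(i, j). 1)"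

end

theory Submission
  imports Defs
begin

text \<open>The spectrum of a block diagonal matrix is the union of the spectra of its blocks
  (\<open>spectrum_diag_block_mat\<close>), because the characteristic determinant factors over the
  blocks. An all-ones block of size k >= 1 has the eigenvalue k
  (\<open>eigenvalue_all_ones_mat_dim\<close>), and any eigenvalue is 0 or k
  (\<open>eigenvalue_all_ones_matD\<close>). Hence the largest block size is an eigenvalue, and no
  eigenvalue has a larger norm.\<close>

lemma spectrum_four_block_diag:
  fixes A B :: "'a :: field mat"
  assumes A: "A \<in> carrier_mat n n" and B: "B \<in> carrier_mat m m"
  shows "spectrum (four_block_mat A (0\<^sub>m n m) (0\<^sub>m m n) B) = spectrum A \<union> spectrum B"
proof -
  have C: "four_block_mat A (0\<^sub>m n m) (0\<^sub>m m n) B \<in> carrier_mat (n + m) (n + m)"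
    using A B by auto
  have "char_matrix (four_block_mat A (0\<^sub>m n m) (0\<^sub>m m n) B) e =
    four_block_mat (char_matrix A e) (0\<^sub>m n m) (0\<^sub>m m n) (char_matrix B e)" for e
    using A B by (intro eq_matI) (auto simp: char_matrix_def)
  \<comment> \<open>Eigenvalues are the zeros of this determinant, and in a field a product vanishes
    iff one of its factors does.\<close>
  moreover have "det (four_block_mat (char_matrix A e) (0\<^sub>m n m) (0\<^sub>m m n) (char_matrix B e)) =
    det (char_matrix A e) * det (char_matrix B e)" for e
    using A B by (intro det_four_block_mat_upper_right_zero) auto
  ultimately show ?thesis
    unfolding spectrum_def
    by (auto simp: eigenvalue_det[OF A] eigenvalue_det[OF B] eigenvalue_det[OF C])
qed

text \<open>Induction on the list: \<open>diag_block_mat\<close> peels off its head as the upper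
  left block of a \<open>four_block_mat\<close>, so the two-block case applies at each step.\<close>

lemma spectrum_diag_block_mat:
  fixes As :: "'a :: field mat list"
  assumes "\<forall>A \<in> set As. square_mat A"
  shows "spectrum (diag_block_mat As) = (\<Union>A \<in> set As. spectrum A)"
  using assms
proof (induction As)
  case Nil
  \<comment> \<open>The dimension bounds the number of eigenvalues, so a 0 x 0 matrix has
    none.\<close>
  have "spectrum (0\<^sub>m 0 0 :: 'a mat) = {}"
    using card_finite_spectrum[of "0\<^sub>m 0 0 :: 'a mat" 0] by auto
  then show ?case by simp
next
  case (Cons A As)
  let ?B = "diag_block_mat As"
  have A: "A \<in> carrier_mat (dim_row A) (dim_row A)"
    and B: "?B \<in> carrier_mat (dim_row ?B) (dim_row ?B)"
    using Cons.prems diag_block_mat_square[of As] by auto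
  have "spectrum (diag_block_mat (A # As)) = spectrum A \<union> spectrum ?B"
    using spectrum_four_block_diag[OF A B] carrier_matD(2)[OF A] carrier_matD(2)[OF B]
    unfolding diag_block_mat.simps Let_def by metis
  then show ?case
    using Cons.IH Cons.prems by simp
qed

lemma all_ones_mat_carrier: "all_ones_mat k \<in> carrier_mat k k"
  by (simp add: all_ones_mat_def)

lemma all_ones_mat_mult_vec:
  fixes v :: "'a :: comm_semiring_1 vec"
  assumes "dim_vec v = k"
  shows "all_ones_mat k *\<^sub>v v = vec k (\<lambda>_. \<Sum>j<k. v $ j)"
  using assms by (intro eq_vecI) (auto simp: all_ones_mat_def scalar_prod_def lessThan_atLeast0)

text \<open>The constant vector 1 is an eigenvector; \<open>k \<ge> 1\<close> makes it
  nonzero.\<close>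

lemma eigenvalue_all_ones_mat_dim:
  assumes "k \<ge> 1"
  shows "eigenvalue (all_ones_mat k :: 'a :: field mat) (of_nat k)"
proof -
  let ?v = "vec k (\<lambda>_. 1 :: 'a)"
  have "all_ones_mat k *\<^sub>v ?v = of_nat k \<cdot>\<^sub>v ?v"
    by (subst all_ones_mat_mult_vec) auto
  moreover have "?v \<noteq> 0\<^sub>v k"
    using assms by (auto simp: vec_eq_iff intro: exI[of _ 0])
  ultimately show ?thesis
    unfolding eigenvalue_def eigenvector_def
    by (intro exI[of _ ?v]) (auto simp: all_ones_mat_def)
qed

text \<open>Every coordinate of the image of v is the coordinate sum s of v, so e * v_i = s for all
  i. Summing over i gives e * s = k * s. If e differs from k, then s = 0, and a nonzero coordinate
  of v forces e = 0.\<close>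

lemma eigenvalue_all_ones_matD:
  assumes "eigenvalue (all_ones_mat k :: 'a :: field mat) e"
  shows "e = 0 \<or> e = of_nat k"
proof (rule disjCI)
  assume ne: "e \<noteq> of_nat k"
  obtain v where "eigenvector (all_ones_mat k) v e"
    using assms unfolding eigenvalue_def by blast
  then have dim: "dim_vec v = k" and v0: "v \<noteq> 0\<^sub>v k"
    and ev: "all_ones_mat k *\<^sub>v v = e \<cdot>\<^sub>v v"
    unfolding eigenvector_def carrier_matD[OF all_ones_mat_carrier] by auto
  define s where "s = (\<Sum>j<k. v $ j)"
  have row: "e * v $ i = s" if "i < k" for i
    using arg_cong[OF ev[symmetric], of "\<lambda>w. w $ i"] that dim
    by (simp add: all_ones_mat_mult_vec s_def)
  have "e * s = of_nat k * s"
  proof -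
    have "e * s = (\<Sum>j<k. e * v $ j)" by (simp add: s_def sum_distrib_left)
    also have "\<dots> = (\<Sum>j<k. s)" by (intro sum.cong refl row) simp
    finally show ?thesis by simp
  qed
  with ne have "s = 0" by simp
  moreover obtain i where "i < k" "v $ i \<noteq> 0"
    using v0 dim by (auto simp: vec_eq_iff)
  ultimately show "e = 0" using row by auto
qed

theorem theorem1:
  fixes m :: nat and n :: "nat \<Rightarrow> nat" and A :: "complex mat"
  assumes "m \<ge> 1"
    and "\<And>i. i \<in> {1..m} \<Longrightarrow> n i \<ge> 1"
    and "A = diag_block_mat (map (\<lambda>i. all_ones_mat (n i)) [1..<m + 1])"
  shows "spectral_radius A = real (Max (n ` {1..m}))"
proof -
  let ?M = "Max (n ` {1..m})"
  have "spectrum A = (\<Union>i \<in> {1..m}. spectrum (all_ones_mat (n i)))"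
    \<comment> \<open>The index set is put in the half-open form of \<open>[1..<m + 1]\<close>,
      which is kept folded so that the two match.\<close>
    unfolding assms(3) atLeastLessThanSuc_atLeastAtMost[symmetric]
    by (subst spectrum_diag_block_mat) (auto simp: all_ones_mat_def simp del: upt_Suc)
  then have spec: "e \<in> spectrum A \<longleftrightarrow> (\<exists>i \<in> {1..m}. eigenvalue (all_ones_mat (n i)) e)" for e
    by (auto simp: spectrum_def)
  \<comment> \<open>\<open>spectral_radius\<close> is a \<open>Max\<close> over the norms of the
    spectrum, so finiteness is needed before it can be evaluated.\<close>
  have "square_mat A"
    unfolding assms(3) by (rule diag_block_mat_square) (auto simp: all_ones_mat_def)
  then have fin: "finite (spectrum A)"
    using card_finite_spectrum(1)[of A "dim_row A"] by auto
  have "?M \<in> n ` {1..m}"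
    using assms(1) by (intro Max_in) auto
  then obtain i where i: "i \<in> {1..m}" "?M = n i" by auto
  then have "of_nat ?M \<in> spectrum A"
    using spec assms(2) eigenvalue_all_ones_mat_dim by metis
  then have mem: "real ?M \<in> norm ` spectrum A"
    by (metis imageI norm_of_nat)
  \<comment> \<open>An eigenvalue comes from some block j, so its norm is 0 or
    \<open>n j\<close>.\<close>
  have "norm e \<le> real ?M" if e: "e \<in> spectrum A" for e
  proof -
    obtain j where j: "j \<in> {1..m}" "e = 0 \<or> e = of_nat (n j)"
      using e spec eigenvalue_all_ones_matD by blast
    then have "n j \<le> ?M" by simp
    with j(2) show ?thesis by auto
  qed
  with fin mem show ?thesis
    unfolding spectral_radius_def by (intro Max_eqI) auto
qed

end
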